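(* Let $n\geq 3$ be an integer and let $\Pi_n$ be the prism graph (circular ladder graph) on $2n$ vertices. Then $$\gamma_{plsR}(\Pi_n)=\begin{cases}\left\lceil\frac{6n}{5}\right\rceil+1, & \text{if } n\equiv 4 \pmod{10} \text{ or } n\equiv 5\pmod{10},\\ \left\lceil\frac{6n}{5}\right\rceil, & \text{otherwise.}\end{cases}$$
   Context: All graphs are finite, without loops or parallel edges. The prism graph $\Pi_n$ is the skeleton of an $n$-prism: it has vertices $a_1,\ldots,a_n,b_1,\ldots,b_n$ and edges $a_ia_{i+1}$, $b_ib_{i+1}$, $a_ib_i$ for $1\leq i\leq n$, with indices taken modulo $n$ (equivalently, the ladder graph with the corresponding boundary vertices joined, or the generalized Petersen graph $GP(n,1)$). For a graph $G=(V,E)$ and $v\in V$, $N[v]=\{v\}\cup\{u : uv\in E\}$ is the closed neighborhood. A perfect locating signed Roman dominating (PLSRD) function on $G=(V,E)$ is a function $f: V\to\{-1,1,2\}$ such that: (C1) each vertex $v$ with $f(v)=-1$ is adjacent to exactly one vertex $u$ with $f(u)=2$; (C2) distinct vertices $v,w$ with $f(v)=f(w)=-1$ have no common neighbor $u$ with $f(u)=2$; (C3) for every vertex $v$, $\sum_{u\in N[v]} f(u)\geq 1$. The weight of $f$ is $f(V)=\sum_{v\in V} f(v)$. The perfect locating signed Roman domination number $\gamma_{plsR}(G)$ is the minimum weight over all PLSRD functions on $G$. *)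

theory Defs
  imports "Graph_Theory.Graph_Theory" Complex_Main
begin

text \<open>
  A finite graph without loops or parallel edges is an instance of the locale \<^locale>\<open>graph\<close>,
  where an undirected edge is represented by its two orientations. The definitions below are
  intended for such graphs. The prefix \<open>plsrd\<close> stands for perfect locating signed Roman domination.
\<close>

definition closed_nbhd :: "('a, 'b) pre_digraph \<Rightarrow> 'a \<Rightarrow> 'a set" where
  "closed_nbhd G v = insert v {u. u \<rightarrow>\<^bsub>G\<^esub> v}"

definition plsrd_fun :: "('a, 'b) pre_digraph \<Rightarrow> ('a \<Rightarrow> int) \<Rightarrow> bool" where
  "plsrd_fun G f \<longleftrightarrow>
     (\<forall>v\<in>verts G. f v \<in> {-1, 1, 2}) \<and>
     (\<forall>v\<in>verts G. f v = -1 \<longrightarrow> (\<exists>!u. u \<rightarrow>\<^bsub>G\<^esub> v \<and> f u = 2)) \<and>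
     (\<forall>v\<in>verts G. \<forall>w\<in>verts G. v \<noteq> w \<and> f v = -1 \<and> f w = -1 \<longrightarrow>
        \<not> (\<exists>u. u \<rightarrow>\<^bsub>G\<^esub> v \<and> u \<rightarrow>\<^bsub>G\<^esub> w \<and> f u = 2)) \<and>
     (\<forall>v\<in>verts G. (\<Sum>u\<in>closed_nbhd G v. f u) \<ge> 1)"

definition plsrd_weight :: "('a, 'b) pre_digraph \<Rightarrow> ('a \<Rightarrow> int) \<Rightarrow> int" where
  "plsrd_weight G f = (\<Sum>v\<in>verts G. f v)"

definition plsrd_number :: "('a, 'b) pre_digraph \<Rightarrow> int" where
  "plsrd_number G = Min {plsrd_weight G f | f. plsrd_fun G f}"

text \<open>
  The minimum is over a finite nonempty set: values outside \<^term>\<open>verts G\<close> do not affect the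
  weight, and the constant function 1 is admissible.
\<close>

lemma (in graph) finite_plsrd_weights: "finite {plsrd_weight G f | f. plsrd_fun G f}"
proof (rule finite_subset)
  show "{plsrd_weight G f | f. plsrd_fun G f} \<subseteq> {- int (card (verts G)) .. 2 * int (card (verts G))}"
  proof
    fix x assume "x \<in> {plsrd_weight G f | f. plsrd_fun G f}"
    then obtain f where x: "x = sum f (verts G)" and f: "plsrd_fun G f"
      by (auto simp: plsrd_weight_def)
    have b: "-1 \<le> f v \<and> f v \<le> 2" if "v \<in> verts G" for v
      using f that unfolding plsrd_fun_def by fastforce
    show "x \<in> {- int (card (verts G)) .. 2 * int (card (verts G))}"
      using sum_bounded_below[of "verts G" "-1" f] sum_bounded_above[of "verts G" f 2] b
      by (simp add: x mult.commute)
  qed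
qed simp

lemma (in graph) plsrd_fun_const_1: "plsrd_fun G (\<lambda>_. 1)"
proof -
  have "finite (closed_nbhd G v)" if "v \<in> verts G" for v
    by (rule finite_subset[of _ "verts G"]) (auto simp: closed_nbhd_def that)
  then have "card (closed_nbhd G v) \<ge> 1" if "v \<in> verts G" for v
    using that by (auto simp: Suc_le_eq card_gt_0_iff closed_nbhd_def)
  then show ?thesis
    by (auto simp: plsrd_fun_def)
qed

datatype prism_vertex = Va nat | Vb nat

text \<open>Indices are the residues \<open>0, \<dots>, n - 1\<close>, so the vertex usually called \<open>a\<^sub>n\<close> is \<open>a\<^sub>0\<close> here.\<close>

definition prism :: "nat \<Rightarrow> prism_vertex pair_pre_digraph" where
  "prism n = mk_symmetric
     \<lparr> pverts = Va ` {..<n} \<union> Vb ` {..<n},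
       parcs = (\<Union>i\<in>{..<n}. {(Va i, Va (Suc i mod n)), (Vb i, Vb (Suc i mod n)), (Va i, Vb i)}) \<rparr>"

lemma pair_graph_prism:
  assumes "n \<ge> 3"
  shows "pair_graph (prism n)"
proof -
  have ne: "Suc i mod n \<noteq> i" if "i < n" for i
    using that assms by (cases "Suc i = n") auto
  let ?H = "\<lparr> pverts = Va ` {..<n} \<union> Vb ` {..<n},
       parcs = (\<Union>i\<in>{..<n}. {(Va i, Va (Suc i mod n)), (Vb i, Vb (Suc i mod n)), (Va i, Vb i)}) \<rparr>"
  interpret H: pair_digraph ?H
  proof
    fix e assume e: "e \<in> parcs ?H"
    show "fst e \<in> pverts ?H" "snd e \<in> pverts ?H" using e assms by auto
    show "fst e \<noteq> snd e" using e by (auto dest: ne sym)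
  qed auto
  interpret P: pair_digraph "prism n"
    unfolding prism_def by (rule H.digraph_mk_symmetric)
  show ?thesis
    by unfold_locales (simp add: prism_def symmetric_mk_symmetric)
qed

lemma card_verts_prism: "card (verts (prism n)) = 2 * n"
proof -
  have "card (Va ` {..<n} \<union> Vb ` {..<n}) = card (Va ` {..<n}) + card (Vb ` {..<n})"
    by (rule card_Un_disjoint) auto
  then show ?thesis
    by (simp add: prism_def card_image inj_on_def)
qed

end

theory Submission
  imports Defs
begin

text \<open>
  A labelling of the prism is a cyclic sequence of columns \<open>(f a\<^sub>i, f b\<^sub>i)\<close>, and it is a PLSRD function
  iff each window of three consecutive columns satisfies a local condition. For the lower bound,
  give each window the slack 5 times the sum of its middle column, minus 6, plus the difference of a
  potential on pairs of consecutive columns. Every slack is nonnegative and the slacks add up to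
  \<open>5 W - 6 n\<close> for the weight \<open>W\<close>, so \<open>5 W \<ge> 6 n\<close>. If \<open>5 W - 6 n \<le> 1\<close>, then all slacks are at most 1,
  and for such windows a two-colouring of pairs of columns changes exactly when the sum of the
  middle column is even; returning to the initial colour after \<open>n\<close> steps makes \<open>n + W\<close> even. This
  excludes \<open>W = \<lceil>6n/5\<rceil>\<close> when \<open>n\<close> is 4 or 5 modulo 10. For the upper bound, optimal cyclic
  sequences of lengths 3 to 12 starting with the same two columns are prolonged by copies of the
  one of length 10, which has weight 12.
\<close>

type_synonym column = "int \<times> int"

definition column_sum :: "column \<Rightarrow> int" where
  "column_sum p = fst p + snd p"

text \<open>\<open>y\<close> is the value at a vertex, \<open>x\<close> and \<open>z\<close> those
  at its neighbours in the same row, \<open>w\<close> the one across the rung. The conjuncts are the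
  value set, (C1), (C2) read at the common neighbour, and (C3).\<close>

definition vertex_ok :: "int \<Rightarrow> int \<Rightarrow> int \<Rightarrow> int \<Rightarrow> bool" where
  "vertex_ok y x z w \<longleftrightarrow>
     (y = -1 \<or> y = 1 \<or> y = 2) \<and>
     (y = -1 \<longrightarrow> (x = 2 \<and> z \<noteq> 2 \<and> w \<noteq> 2) \<or> (x \<noteq> 2 \<and> z = 2 \<and> w \<noteq> 2) \<or> (x \<noteq> 2 \<and> z \<noteq> 2 \<and> w = 2)) \<and>
     (y = 2 \<longrightarrow> \<not> (x = -1 \<and> z = -1) \<and> \<not> (x = -1 \<and> w = -1) \<and> \<not> (z = -1 \<and> w = -1)) \<and>
     y + x + z + w \<ge> 1"

definition window_ok :: "column \<Rightarrow> column \<Rightarrow> column \<Rightarrow> bool" where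
  "window_ok p q r \<longleftrightarrow>
     vertex_ok (fst q) (fst p) (fst r) (snd q) \<and> vertex_ok (snd q) (snd p) (snd r) (fst q)"

section \<open>Labellings of the prism as periodic sequences of columns\<close>

text \<open>
  Condition (C2), read from the common neighbour, says that a vertex with value 2 has at most one
  neighbour with value -1; so all three conditions become local to closed neighbourhoods.
\<close>

lemma (in graph) plsrd_fun_iff_local:
  "plsrd_fun G f \<longleftrightarrow> (\<forall>v\<in>verts G.
     f v \<in> {-1, 1, 2} \<and>
     (f v = -1 \<longrightarrow> (\<exists>!u. u \<rightarrow>\<^bsub>G\<^esub> v \<and> f u = 2)) \<and>
     (f v = 2 \<longrightarrow> (\<forall>u w. u \<rightarrow>\<^bsub>G\<^esub> v \<and> w \<rightarrow>\<^bsub>G\<^esub> v \<and> f u = -1 \<and> f w = -1 \<longrightarrow> u = w)) \<and>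
     (\<Sum>u\<in>closed_nbhd G v. f u) \<ge> 1)"
proof -
  have sym: "u \<rightarrow>\<^bsub>G\<^esub> v \<longleftrightarrow> v \<rightarrow>\<^bsub>G\<^esub> u" for u v
    using sym_arcs by (auto simp: symmetric_def dest: symD)
  have wf: "u \<in> verts G \<and> v \<in> verts G" if "u \<rightarrow>\<^bsub>G\<^esub> v" for u v
    using that by (auto intro: adj_in_verts)
  have "(\<forall>v\<in>verts G. \<forall>w\<in>verts G. v \<noteq> w \<and> f v = -1 \<and> f w = -1 \<longrightarrow>
          \<not> (\<exists>u. u \<rightarrow>\<^bsub>G\<^esub> v \<and> u \<rightarrow>\<^bsub>G\<^esub> w \<and> f u = 2)) \<longleftrightarrow>
        (\<forall>v\<in>verts G. f v = 2 \<longrightarrow>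
          (\<forall>u w. u \<rightarrow>\<^bsub>G\<^esub> v \<and> w \<rightarrow>\<^bsub>G\<^esub> v \<and> f u = -1 \<and> f w = -1 \<longrightarrow> u = w))"
    (is "?L \<longleftrightarrow> ?R")
  proof
    assume L: ?L
    show ?R
    proof (intro ballI impI allI, elim conjE)
      fix v u w assume "f v = 2" "u \<rightarrow>\<^bsub>G\<^esub> v" "w \<rightarrow>\<^bsub>G\<^esub> v" "f u = -1" "f w = -1"
      then show "u = w"
        using L wf sym[of u v] sym[of w v] by (cases "u = w") blast+
    qed
  next
    assume R: ?R
    show ?L
    proof (intro ballI impI notI, elim conjE exE)
      fix v w u assume "v \<noteq> w" "f v = -1" "f w = -1" "u \<rightarrow>\<^bsub>G\<^esub> v" "u \<rightarrow>\<^bsub>G\<^esub> w" "f u = 2"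
      then show False
        using R wf[of u v] sym[of u v] sym[of u w] by blast
    qed
  qed
  then show ?thesis
    unfolding plsrd_fun_def ball_conj_distrib by simp
qed

text \<open>As the four vertices are distinct, the sum splits into four terms and uniqueness among
  the neighbours becomes a case distinction on their values.\<close>

lemma vertex_ok_iff:
  assumes nbhd: "\<And>u. u \<rightarrow>\<^bsub>G\<^esub> v \<longleftrightarrow> u \<in> {x, z, w}" and "distinct [v, x, z, w]"
  shows "vertex_ok (f v) (f x) (f z) (f w) \<longleftrightarrow>
     f v \<in> {-1, 1, 2} \<and>
     (f v = -1 \<longrightarrow> (\<exists>!u. u \<rightarrow>\<^bsub>G\<^esub> v \<and> f u = 2)) \<and>
     (f v = 2 \<longrightarrow> (\<forall>u w. u \<rightarrow>\<^bsub>G\<^esub> v \<and> w \<rightarrow>\<^bsub>G\<^esub> v \<and> f u = -1 \<and> f w = -1 \<longrightarrow> u = w)) \<and>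
     (\<Sum>u\<in>closed_nbhd G v. f u) \<ge> 1"
proof -
  have "closed_nbhd G v = {v, x, z, w}"
    using nbhd by (auto simp: closed_nbhd_def)
  then have s: "(\<Sum>u\<in>closed_nbhd G v. f u) = f v + f x + f z + f w"
    using assms(2) by simp
  have e: "(\<exists>!u. u \<in> {x, z, w} \<and> f u = 2) \<longleftrightarrow>
     (f x = 2 \<and> f z \<noteq> 2 \<and> f w \<noteq> 2) \<or> (f x \<noteq> 2 \<and> f z = 2 \<and> f w \<noteq> 2) \<or> (f x \<noteq> 2 \<and> f z \<noteq> 2 \<and> f w = 2)"
    using assms(2) by (cases "f x = 2"; cases "f z = 2"; cases "f w = 2") auto
  have m: "(\<forall>u y. u \<in> {x, z, w} \<and> y \<in> {x, z, w} \<and> f u = -1 \<and> f y = -1 \<longrightarrow> u = y) \<longleftrightarrow>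
     \<not> (f x = -1 \<and> f z = -1) \<and> \<not> (f x = -1 \<and> f w = -1) \<and> \<not> (f z = -1 \<and> f w = -1)"
    using assms(2) by auto
  show ?thesis
    unfolding nbhd s e m vertex_ok_def by auto
qed

definition prism_column :: "nat \<Rightarrow> (prism_vertex \<Rightarrow> int) \<Rightarrow> nat \<Rightarrow> column" where
  "prism_column n f i = (f (Va (i mod n)), f (Vb (i mod n)))"

lemma prism_adj:
  assumes "n \<ge> 3"
  shows prism_adj_Va: "u \<rightarrow>\<^bsub>prism n\<^esub> Va (Suc i mod n) \<longleftrightarrow>
      u \<in> {Va (i mod n), Va (Suc (Suc i) mod n), Vb (Suc i mod n)}"
    and prism_adj_Vb: "u \<rightarrow>\<^bsub>prism n\<^esub> Vb (Suc i mod n) \<longleftrightarrow>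
      u \<in> {Vb (i mod n), Vb (Suc (Suc i) mod n), Va (Suc i mod n)}"
proof -
  have "Suc i mod n = Suc j mod n \<longleftrightarrow> i mod n = j" if "j < n" for j
    using that assms by (auto simp: mod_Suc split: if_splits)
  moreover have "Suc i mod n < n" "Suc (Suc i) mod n = Suc (Suc i mod n) mod n"
    using assms by (auto simp: mod_Suc_eq)
  ultimately show "u \<rightarrow>\<^bsub>prism n\<^esub> Va (Suc i mod n) \<longleftrightarrow>
      u \<in> {Va (i mod n), Va (Suc (Suc i) mod n), Vb (Suc i mod n)}"
    and "u \<rightarrow>\<^bsub>prism n\<^esub> Vb (Suc i mod n) \<longleftrightarrow>
      u \<in> {Vb (i mod n), Vb (Suc (Suc i) mod n), Va (Suc i mod n)}"
    using assms by (cases u; auto simp: prism_def parcs_mk_symmetric)+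
qed

lemma plsrd_fun_prism_iff:
  assumes "n \<ge> 3"
  shows "plsrd_fun (prism n) f \<longleftrightarrow>
    (\<forall>i. window_ok (prism_column n f i) (prism_column n f (Suc i)) (prism_column n f (Suc (Suc i))))"
proof -
  have graph: "graph (prism n)"
  proof -
    interpret pair_graph "prism n"
      using assms by (rule pair_graph_prism)
    show ?thesis
      by unfold_locales
  qed
  \<comment> \<open>Since \<open>n \<ge> 3\<close>, three consecutive residues are distinct, so a
    vertex has three different neighbours.\<close>
  have mod_ne: "i mod n \<noteq> Suc i mod n" "i mod n \<noteq> Suc (Suc i) mod n" for i
    using assms by (auto simp: mod_Suc split: if_splits)
  let ?local = "\<lambda>v. f v \<in> {-1, 1, 2} \<and>
     (f v = -1 \<longrightarrow> (\<exists>!u. u \<rightarrow>\<^bsub>prism n\<^esub> v \<and> f u = 2)) \<and>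
     (f v = 2 \<longrightarrow> (\<forall>u w. u \<rightarrow>\<^bsub>prism n\<^esub> v \<and> w \<rightarrow>\<^bsub>prism n\<^esub> v \<and> f u = -1 \<and> f w = -1 \<longrightarrow> u = w)) \<and>
     (\<Sum>u\<in>closed_nbhd (prism n) v. f u) \<ge> 1"
  have window: "window_ok (prism_column n f i) (prism_column n f (Suc i)) (prism_column n f (Suc (Suc i)))
      \<longleftrightarrow> ?local (Va (Suc i mod n)) \<and> ?local (Vb (Suc i mod n))" for i
    unfolding window_ok_def prism_column_def fst_conv snd_conv
    using vertex_ok_iff[OF prism_adj_Va[OF assms], of i f] vertex_ok_iff[OF prism_adj_Vb[OF assms], of i f]
      mod_ne[of i] mod_ne[of "Suc i"] by simp
  \<comment> \<open>The witness is the predecessor of \<open>j\<close> modulo \<open>n\<close>;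
    adding \<open>n\<close> keeps the subtraction exact at \<open>j = 0\<close>.\<close>
  have "\<exists>i. j = Suc i mod n" if "j < n" for j
    using that assms by (intro exI[of _ "j + n - 1"]) simp
  moreover have "Suc i mod n < n" for i
    using assms by simp
  ultimately have vertices: "(\<forall>v\<in>verts (prism n). P v) \<longleftrightarrow> (\<forall>i. P (Va (Suc i mod n)) \<and> P (Vb (Suc i mod n)))" for P
    by (auto simp: prism_def)
  show ?thesis
    unfolding graph.plsrd_fun_iff_local[OF graph] window by (rule vertices)
qed

lemma plsrd_weight_prism:
  "plsrd_weight (prism n) f = (\<Sum>i<n. column_sum (prism_column n f i))"
proof -
  have "plsrd_weight (prism n) f = sum f (Va ` {..<n} \<union> Vb ` {..<n})"
    by (simp add: plsrd_weight_def prism_def)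
  also have "\<dots> = sum f (Va ` {..<n}) + sum f (Vb ` {..<n})"
    by (rule sum.union_disjoint) auto
  also have "\<dots> = (\<Sum>i<n. f (Va i)) + (\<Sum>i<n. f (Vb i))"
    by (simp add: sum.reindex inj_on_def)
  finally show ?thesis
    by (simp add: column_sum_def prism_column_def sum.distrib)
qed

section \<open>Lower bound\<close>

text \<open>
  The potential, invariant under exchanging the two rows and listed only up to this exchange, and
  the colour class of \<open>parity_class\<close> are a solution, found by an SMT solver, of the constraints that
  \<open>window_check\<close> verifies.
\<close>

definition potential_table :: "((column \<times> column) \<times> int) list" where
  "potential_table =
    [(((-1, -1), (1, 1)), -2), (((-1, -1), (1, 2)), -7), (((-1, -1), (2, 2)), -12),
     (((-1, 1), (-1, 2)), 1), (((-1, 1), (2, -1)), -8), (((-1, 1), (2, 1)), -7),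
     (((-1, 1), (2, 2)), -6), (((-1, 2), (-1, 2)), 1), (((-1, 2), (1, -1)), 9),
     (((1, 1), (-1, -1)), 4), (((1, 1), (-1, 2)), 2), (((1, 2), (-1, -1)), 9),
     (((1, 2), (-1, 2)), 2), (((1, 2), (1, -1)), 8), (((2, 2), (-1, -1)), 14),
     (((2, 2), (-1, 1)), 8)]"

definition potential :: "column \<Rightarrow> column \<Rightarrow> int" where
  "potential p q = (case map_of potential_table (p, q) of Some x \<Rightarrow> x | None \<Rightarrow>
     (case map_of potential_table (prod.swap p, prod.swap q) of Some x \<Rightarrow> x | None \<Rightarrow> 0))"

definition parity_class :: "(column \<times> column) list" where
  "parity_class =
    [((-1, -1), (-1, 1)), ((-1, -1), (1, 2)), ((-1, 1), (-1, 1)), ((-1, 1), (-1, 2)),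
     ((-1, 1), (1, 2)), ((-1, 2), (-1, 1)), ((-1, 2), (-1, 2)), ((-1, 2), (1, 1)),
     ((-1, 2), (1, 2)), ((1, -1), (-1, 1)), ((1, -1), (1, 2)), ((1, -1), (2, 2)),
     ((1, 1), (-1, -1)), ((1, 1), (-1, 1)), ((1, 1), (-1, 2)), ((1, 1), (1, 2)),
     ((1, 2), (-1, -1)), ((1, 2), (-1, 1)), ((1, 2), (-1, 2)), ((1, 2), (1, -1)),
     ((1, 2), (1, 2)), ((2, -1), (-1, 2)), ((2, 1), (1, 2)), ((2, 2), (-1, -1)),
     ((2, 2), (1, -1)), ((2, 2), (1, 2))]"

definition slack :: "column \<Rightarrow> column \<Rightarrow> column \<Rightarrow> int" where
  "slack p q r = 5 * column_sum q - 6 + potential p q - potential q r"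

definition columns :: "column list" where
  "columns = List.product [-1, 1, 2] [-1, 1, 2]"

text \<open>A finite check over 9^3 triples of columns, settled by evaluation.\<close>

lemma window_check:
  "\<forall>p\<in>set columns. \<forall>q\<in>set columns. \<forall>r\<in>set columns. window_ok p q r \<longrightarrow>
     0 \<le> slack p q r \<and>
     (slack p q r \<le> 1 \<longrightarrow>
        ((q, r) \<in> set parity_class \<longleftrightarrow> ((p, q) \<in> set parity_class \<longleftrightarrow> odd (column_sum q))))"
  by code_simp

lemma window_bound:
  assumes "p \<in> set columns" "q \<in> set columns" "r \<in> set columns" "window_ok p q r"
  shows "0 \<le> slack p q r"
    and "slack p q r \<le> 1 \<Longrightarrow>
      (q, r) \<in> set parity_class \<longleftrightarrow> ((p, q) \<in> set parity_class \<longleftrightarrow> odd (column_sum q))"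
  using window_check assms by blast+

lemma window_ok_column:
  assumes "window_ok p q r"
  shows "q \<in> set columns"
  using assms by (cases q) (auto simp: window_ok_def vertex_ok_def columns_def)

lemma periodic_windows_bound:
  fixes d :: "nat \<Rightarrow> column"
  assumes ok: "\<And>i. window_ok (d i) (d (Suc i)) (d (Suc (Suc i)))"
    and period: "\<And>i. d (i + n) = d i" and "n > 0"
  defines "w \<equiv> \<Sum>i<n. column_sum (d i)"
  shows "6 * int n \<le> 5 * w"
    and "5 * w \<le> 6 * int n + 1 \<Longrightarrow> even (int n + w)"
proof -
  define s where "s i = slack (d i) (d (Suc i)) (d (Suc (Suc i)))" for i
  \<comment> \<open>A window constrains the range of its middle column only, so \<open>d i\<close>
    is viewed as the middle of the window starting at \<open>i + n - 1\<close>.\<close>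
  have col: "d i \<in> set columns" for i
    using window_ok_column[OF ok, of "i + n - 1"] period[of i] \<open>n > 0\<close> by simp
  \<comment> \<open>Slacks are indexed by the first column of a window, so the middle columns run
    from \<open>d 1\<close> to \<open>d n = d 0\<close>.\<close>
  have shift: "(\<Sum>i<n. column_sum (d (Suc i))) = w"
    using sum.lessThan_Suc_shift[of "\<lambda>i. column_sum (d i)" n] period[of 0]
    by (simp add: w_def)
  have "(\<Sum>i<n. s i) = (\<Sum>i<n. 5 * column_sum (d (Suc i)) - 6)
      - (\<Sum>i<n. potential (d (Suc i)) (d (Suc (Suc i))) - potential (d i) (d (Suc i)))"
    by (simp add: s_def slack_def algebra_simps flip: sum_subtractf)
  also have "\<dots> = 5 * w - 6 * int n"
    using period[of 0] period[of "Suc 0"] shift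
      sum_lessThan_telescope[of "\<lambda>i. potential (d i) (d (Suc i))" n]
    by (simp add: sum_subtractf flip: sum_distrib_left)
  finally have total: "(\<Sum>i<n. s i) = 5 * w - 6 * int n" .
  have nonneg: "0 \<le> s i" for i
    unfolding s_def using col ok by (intro window_bound)
  show "6 * int n \<le> 5 * w"
    using total sum_nonneg[of "{..<n}" s] nonneg by simp
  assume "5 * w \<le> 6 * int n + 1"
  then have small: "s i \<le> 1" if "i < n" for i
    using total member_le_sum[of i "{..<n}" s] nonneg that by simp
  define t where "t i \<longleftrightarrow> (d i, d (Suc i)) \<in> set parity_class" for i
  have "t (Suc i) \<longleftrightarrow> (t i \<longleftrightarrow> odd (column_sum (d (Suc i))))" if "i < n" for i
    unfolding t_def using window_bound(2)[OF col col col ok] small[OF that] by (simp add: s_def)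
  \<comment> \<open>The colour flips exactly when \<open>1 + column_sum\<close> is odd, so the
    parity of the partial sum decides whether it differs from \<open>t 0\<close>.\<close>
  then have "t k \<longleftrightarrow> (t 0 \<longleftrightarrow> even (\<Sum>i<k. 1 + column_sum (d (Suc i))))" if "k \<le> n" for k
    using that by (induction k) auto
  from this[of n] have "even (\<Sum>i<n. 1 + column_sum (d (Suc i)))"
    using period[of 0] period[of "Suc 0"] by (auto simp: t_def)
  then show "even (int n + w)"
    by (simp add: sum.distrib shift)
qed

text \<open>\<open>(6 * int n + 4) div 5\<close> is the ceiling of \<open>6n/5\<close>, kept in
  integer arithmetic for linear decision procedures.\<close>

definition prism_value :: "nat \<Rightarrow> int" where
  "prism_value n = (6 * int n + 4) div 5 + (if n mod 10 = 4 \<or> n mod 10 = 5 then 1 else 0)"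

lemma prism_value_le_weight:
  assumes "n \<ge> 3" "plsrd_fun (prism n) f"
  shows "prism_value n \<le> plsrd_weight (prism n) f"
proof -
  let ?w = "plsrd_weight (prism n) f"
  have period: "prism_column n f (i + n) = prism_column n f i" for i
    by (simp add: prism_column_def)
  have w: "6 * int n \<le> 5 * ?w" "5 * ?w \<le> 6 * int n + 1 \<Longrightarrow> even (int n + ?w)"
    using periodic_windows_bound[of "prism_column n f" n] assms period
    by (auto simp: plsrd_fun_prism_iff plsrd_weight_prism)
  show ?thesis
  proof (cases "n mod 10 = 4 \<or> n mod 10 = 5")
    \<comment> \<open>For \<open>n = 10k + 4\<close> or \<open>10k + 5\<close>, weight
      \<open>12k + 5\<close> or \<open>12k + 6\<close> would leave total slack 1 or 0 with
      \<open>n + w\<close> odd.\<close>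
    case True
    then show ?thesis
      using w unfolding prism_value_def by presburger
  next
    case False
    then show ?thesis
      using w(1) by (simp add: prism_value_def)
  qed
qed

section \<open>Optimal labellings\<close>

fun windows_ok :: "column list \<Rightarrow> bool" where
  "windows_ok (p # q # r # ps) \<longleftrightarrow> window_ok p q r \<and> windows_ok (q # r # ps)"
| "windows_ok _ \<longleftrightarrow> True"

lemma windows_ok_nth:
  "windows_ok ps \<Longrightarrow> Suc (Suc i) < length ps \<Longrightarrow> window_ok (ps ! i) (ps ! Suc i) (ps ! Suc (Suc i))"
  by (induction ps arbitrary: i rule: windows_ok.induct) (auto simp: less_Suc_eq_0_disj)

text \<open>A window spans three columns, so an overlap in two columns puts each window of the
  joined list inside one of the two parts.\<close>

lemma windows_ok_append:
  "windows_ok (ps @ [p, q]) \<Longrightarrow> windows_ok (p # q # qs) \<Longrightarrow> windows_ok (ps @ p # q # qs)"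
  by (induction ps rule: windows_ok.induct) auto

text \<open>Appending the first two columns closes the cycle; all blocks share these two columns so
  that they can be concatenated.\<close>

definition cyclic_labelling :: "column list \<Rightarrow> bool" where
  "cyclic_labelling ps \<longleftrightarrow> (\<exists>qs. ps = (-1, -1) # (1, 2) # qs) \<and> windows_ok (ps @ [(-1, -1), (1, 2)])"

lemma cyclic_labelling_append:
  assumes "cyclic_labelling ps" "cyclic_labelling qs"
  shows "cyclic_labelling (ps @ qs)"
  using assms windows_ok_append[of ps "(-1, -1)" "(1, 2)"] unfolding cyclic_labelling_def by auto

text \<open>Meant for lengths 3 to 12, one per residue modulo 10; the final \<open>else\<close> is
  length 12.\<close>

definition optimal_block :: "nat \<Rightarrow> column list" where
  "optimal_block n = [(-1, -1), (1, 2)] @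
    (if n = 3 then [(2, 1)]
     else if n = 4 then [(1, 1), (2, 1)]
     else if n = 5 then [(-1, 1), (2, 1), (2, 1)]
     else if n = 6 then [(-1, 2), (-1, 2), (1, 1), (2, 1)]
     else if n = 7 then [(-1, 2), (-1, 2), (1, 1), (2, -1), (2, 1)]
     else if n = 8 then [(-1, 2), (-1, 2), (1, 2), (-1, -1), (2, 1), (2, 1)]
     else if n = 9 then [(-1, 2), (-1, 2), (1, 2), (-1, -1), (2, 1), (2, -1), (2, 1)]
     else if n = 10 then [(-1, 2), (-1, 2), (1, 2), (-1, -1), (2, 1), (2, -1), (2, -1), (2, 1)]
     else if n = 11 then [(-1, 2), (-1, 2), (1, 2), (-1, -1), (2, 1), (2, -1), (1, -1), (1, 2), (2, 1)]
     else [(-1, 2), (-1, 2), (1, 2), (-1, -1), (2, 1), (2, -1), (2, 1), (-1, -1), (1, 2), (2, 1)])"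

lemma optimal_block:
  assumes "3 \<le> n" "n \<le> 12"
  shows "cyclic_labelling (optimal_block n)" "length (optimal_block n) = n"
    "sum_list (map column_sum (optimal_block n)) = prism_value n"
proof -
  have "n \<in> {3, 4, 5, 6, 7, 8, 9, 10, 11, 12}"
    using assms unfolding insert_iff empty_iff by presburger
  then show "cyclic_labelling (optimal_block n)" "length (optimal_block n) = n"
    "sum_list (map column_sum (optimal_block n)) = prism_value n"
    by (auto simp: optimal_block_def cyclic_labelling_def window_ok_def vertex_ok_def
        column_sum_def prism_value_def)
qed

text \<open>Ten more columns raise \<open>6n/5\<close> by exactly 12 and preserve the residue modulo
  10.\<close>

lemma prism_value_add_10: "prism_value (n + 10) = prism_value n + 12"
  by (simp add: prism_value_def)

lemma optimal_labelling_exists: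
  assumes "n \<ge> 3"
  shows "\<exists>ps. cyclic_labelling ps \<and> length ps = n \<and> sum_list (map column_sum ps) = prism_value n"
  using assms
proof (induction n rule: less_induct)
  case (less n)
  show ?case
  proof (cases "n \<le> 12")
    case True
    then show ?thesis
      using optimal_block less.prems by blast
  next
    case False
    then have "n - 10 < n" "3 \<le> n - 10"
      by auto
    then obtain ps where "cyclic_labelling ps" "length ps = n - 10"
      "sum_list (map column_sum ps) = prism_value (n - 10)"
      using less.IH[of "n - 10"] by blast
    moreover have "prism_value n = 12 + prism_value (n - 10)"
      using prism_value_add_10[of "n - 10"] False by simp
    moreover have "prism_value 10 = 12"
      by (simp add: prism_value_def)
    ultimately show ?thesis
      using optimal_block[of 10] cyclic_labelling_append[of "optimal_block 10" ps] False
      by (intro exI[of _ "optimal_block 10 @ ps"]) simp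
  qed
qed

lemma prism_value_attained:
  assumes "n \<ge> 3"
  shows "\<exists>f. plsrd_fun (prism n) f \<and> plsrd_weight (prism n) f = prism_value n"
proof -
  obtain ps where ps: "cyclic_labelling ps" "length ps = n"
    "sum_list (map column_sum ps) = prism_value n"
    using optimal_labelling_exists[OF assms] by blast
  define f where "f v = (case v of Va i \<Rightarrow> fst (ps ! i) | Vb i \<Rightarrow> snd (ps ! i))" for v
  have col: "prism_column n f i = ps ! (i mod n)" for i
    by (simp add: prism_column_def f_def)
  let ?qs = "ps @ [(-1, -1), (1, 2)]"
  \<comment> \<open>A window starting below index \<open>n\<close> ends at \<open>n + 1\<close> at
    most, so two appended columns suffice for wrapping around.\<close>
  have wrap: "?qs ! i = ps ! (i mod n)" if "i < n + 2" for i
  proof (cases "i < n")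
    case True
    then show ?thesis
      using ps(2) by (simp add: nth_append)
  next
    case False
    then have "i = n \<or> i = Suc n"
      using that by auto
    moreover have "Suc n mod n = Suc 0"
      using assms by (simp add: mod_Suc)
    ultimately show ?thesis
      using ps(1,2) assms by (auto simp: cyclic_labelling_def nth_append)
  qed
  have "window_ok (ps ! (i mod n)) (ps ! (Suc i mod n)) (ps ! (Suc (Suc i) mod n))" for i
  proof -
    define j where "j = i mod n"
    have j: "j < n" "Suc j mod n = Suc i mod n" "Suc (Suc j) mod n = Suc (Suc i) mod n"
      using assms by (auto simp: j_def mod_Suc_eq mod_Suc_Suc_eq)
    have "window_ok (?qs ! j) (?qs ! Suc j) (?qs ! Suc (Suc j))"
      using ps(1,2) j(1) by (intro windows_ok_nth) (auto simp: cyclic_labelling_def)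
    then show ?thesis
      using wrap[of j] wrap[of "Suc j"] wrap[of "Suc (Suc j)"] j by (simp add: j_def)
  qed
  then have "plsrd_fun (prism n) f"
    using assms by (simp add: plsrd_fun_prism_iff col)
  moreover have "plsrd_weight (prism n) f = prism_value n"
    using ps(2,3) by (simp add: plsrd_weight_prism col sum_list_sum_nth atLeast0LessThan)
  ultimately show ?thesis
    by blast
qed

section \<open>Closed form and conclusion\<close>

lemma prism_value_ceiling:
  "prism_value n =
    (if n mod 10 = 4 \<or> n mod 10 = 5 then \<lceil>6 * real n / 5\<rceil> + 1 else \<lceil>6 * real n / 5\<rceil>)"
proof -
  have "\<lceil>6 * real n / 5\<rceil> = \<lceil>real_of_int (6 * int n) / real_of_int 5\<rceil>"
    by simp
  also have "\<dots> = - (- (6 * int n) div 5)"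
    by (rule ceiling_divide_eq_div)
  also have "\<dots> = (6 * int n + 4) div 5"
    by presburger
  finally show ?thesis
    by (simp add: prism_value_def)
qed

theorem theorem4:
  fixes n :: nat
  assumes "n \<ge> 3"
  shows "plsrd_number (prism n) =
    (if n mod 10 = 4 \<or> n mod 10 = 5 then \<lceil>6 * real n / 5\<rceil> + 1 else \<lceil>6 * real n / 5\<rceil>)"
proof -
  interpret pair_graph "prism n"
    using assms by (rule pair_graph_prism)
  have "plsrd_number (prism n) = prism_value n"
    unfolding plsrd_number_def
  proof (rule Min_eqI)
    show "finite {plsrd_weight (prism n) f |f. plsrd_fun (prism n) f}"
      by (rule finite_plsrd_weights)
    show "prism_value n \<le> y" if "y \<in> {plsrd_weight (prism n) f |f. plsrd_fun (prism n) f}" for y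
      using that prism_value_le_weight[OF assms] by auto
    show "prism_value n \<in> {plsrd_weight (prism n) f |f. plsrd_fun (prism n) f}"
      using prism_value_attained[OF assms] by force
  qed
  then show ?thesis
    by (simp add: prism_value_ceiling)
qed

end
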